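(* Let $\mathcal{H}$ be a complex Hilbert space, $T\in\mathcal{L}(\mathcal{H})$, and let $T=U-V$ be a proper splitting of $T$. If $T^\dagger V\in\mathcal{L}^+$, then $\rho(U^\dagger V)=\dfrac{\rho(T^\dagger V)}{1+\rho(T^\dagger V)}<1$.
   Context: $\mathcal{L}(\mathcal{H})$ is the algebra of bounded linear operators on $\mathcal{H}$; $\mathcal{L}^+$ is the set of positive (semidefinite) operators in $\mathcal{L}(\mathcal{H})$; $\mathcal{R}(\cdot)$ and $\mathcal{N}(\cdot)$ denote range and nullspace; $\rho(\cdot)$ is the spectral radius. A proper splitting of $T$ is a decomposition $T=U-V$ with $U,V\in\mathcal{L}(\mathcal{H})$, $\mathcal{R}(U)=\mathcal{R}(T)$ and $\mathcal{N}(U)=\mathcal{N}(T)$. The range of $T$ is not assumed closed. For $T\in\mathcal{L}(\mathcal{H})$, the Moore-Penrose inverse $T^\dagger$ is the unique densely defined linear operator with domain $\mathcal{R}(T)\oplus\mathcal{R}(T)^\perp$ such that, writing $X=T^\dagger$: $TXT=T$; $XTX=X$ on $\mathcal{R}(T)\oplus\mathcal{R}(T)^\perp$; $XT$ is the orthogonal projection onto $\overline{\mathcal{R}(T^* )}$; and $TX$ is the restriction to $\mathcal{R}(T)\oplus\mathcal{R}(T)^\perp$ of the orthogonal projection onto $\overline{\mathcal{R}(T)}$. It is bounded (everywhere defined) if and only if $\mathcal{R}(T)$ is closed. For a proper splitting, $\mathcal{R}(V)\subseteq\mathcal{R}(T)=\mathcal{R}(U)$, and $T^\dagger V$ and $U^\dagger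 V$ are everywhere defined bounded operators. *)

theory Defs
  imports "HOL-Analysis.Analysis"
begin

text \<open>
  A complex Hilbert space, with an inner product linear in its first argument.  The underlying real
  Hilbert space, with inner product \<open>Re \<langle>x, y\<rangle>\<close>, is part of the structure, so \<open>\<langle>x, x\<rangle> \<ge> 0\<close>, definiteness
  and \<open>norm x = sqrt \<langle>x, x\<rangle>\<close> are inherited from \<^class>\<open>real_inner\<close> and symmetry.
\<close>

class complex_hilbert_space = real_inner + complete_space +
  fixes scaleC :: "complex \<Rightarrow> 'a \<Rightarrow> 'a"  (infixr "*\<^sub>C" 75)
    and cinner :: "'a \<Rightarrow> 'a \<Rightarrow> complex"
  assumes scaleC_add_right: "c *\<^sub>C (x + y) = c *\<^sub>C x + c *\<^sub>C y"
    and scaleC_add_left: "(c + d) *\<^sub>C x = c *\<^sub>C x + d *\<^sub>C x"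
    and scaleC_scaleC: "c *\<^sub>C d *\<^sub>C x = (c * d) *\<^sub>C x"
    and scaleC_one: "1 *\<^sub>C x = x"
    and scaleR_scaleC: "r *\<^sub>R x = complex_of_real r *\<^sub>C x"
    and cinner_commute: "cinner x y = cnj (cinner y x)"
    and cinner_add_left: "cinner (x + y) z = cinner x z + cinner y z"
    and cinner_scaleC_left: "cinner (c *\<^sub>C x) y = c * cinner x y"
    and inner_eq_Re_cinner: "inner x y = Re (cinner x y)"

definition bounded_clinear :: "('a::complex_hilbert_space \<Rightarrow> 'a) \<Rightarrow> bool" where
  "bounded_clinear A \<longleftrightarrow> bounded_linear A \<and> (\<forall>c x. A (c *\<^sub>C x) = c *\<^sub>C A x)"

definition positive_op :: "('a::complex_hilbert_space \<Rightarrow> 'a) \<Rightarrow> bool" where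
  "positive_op A \<longleftrightarrow> bounded_clinear A \<and> (\<forall>x. cinner (A x) x \<in> \<real>\<^sub>\<ge>\<^sub>0)"

definition nullspace :: "('a::complex_hilbert_space \<Rightarrow> 'a) \<Rightarrow> 'a set" where
  "nullspace A = {x. A x = 0}"

definition proper_splitting ::
  "('a::complex_hilbert_space \<Rightarrow> 'a) \<Rightarrow> ('a \<Rightarrow> 'a) \<Rightarrow> ('a \<Rightarrow> 'a) \<Rightarrow> bool" where
  "proper_splitting T U V \<longleftrightarrow>
     bounded_clinear U \<and> bounded_clinear V \<and> T = (\<lambda>x. U x - V x) \<and>
     range U = range T \<and> nullspace U = nullspace T"

definition ortho_compl :: "'a::complex_hilbert_space set \<Rightarrow> 'a set" where
  "ortho_compl M = {x. \<forall>y\<in>M. cinner x y = 0}"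

text \<open>Well defined when \<open>M\<close> is a closed complex subspace.\<close>

definition orth_proj :: "'a::complex_hilbert_space set \<Rightarrow> 'a \<Rightarrow> 'a" where
  "orth_proj M x = (THE y. y \<in> M \<and> x - y \<in> ortho_compl M)"

definition cadjoint :: "('a::complex_hilbert_space \<Rightarrow> 'a) \<Rightarrow> 'a \<Rightarrow> 'a" where
  "cadjoint A = (THE B. \<forall>x y. cinner (A x) y = cinner x (B y))"

definition mp_domain :: "('a::complex_hilbert_space \<Rightarrow> 'a) \<Rightarrow> 'a set" where
  "mp_domain T = {y + z |y z. y \<in> range T \<and> z \<in> ortho_compl (range T)}"

text \<open>
  The Moore-Penrose inverse is an operator defined on \<^term>\<open>mp_domain T\<close> only.  It is represented by
  a total function; the value 0 outside the domain merely makes the representation unique.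
\<close>

definition is_mp_inverse ::
  "('a::complex_hilbert_space \<Rightarrow> 'a) \<Rightarrow> ('a \<Rightarrow> 'a) \<Rightarrow> bool" where
  "is_mp_inverse T X \<longleftrightarrow>
     (\<forall>x\<in>mp_domain T. \<forall>y\<in>mp_domain T. X (x + y) = X x + X y) \<and>
     (\<forall>c. \<forall>x\<in>mp_domain T. X (c *\<^sub>C x) = c *\<^sub>C X x) \<and>
     (\<forall>x. T (X (T x)) = T x) \<and>
     (\<forall>x\<in>mp_domain T. X (T (X x)) = X x) \<and>
     (\<forall>x. X (T x) = orth_proj (closure (range (cadjoint T))) x) \<and>
     (\<forall>x\<in>mp_domain T. T (X x) = orth_proj (closure (range T)) x) \<and>
     (\<forall>x. x \<notin> mp_domain T \<longrightarrow> X x = 0)"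

definition mp_inverse :: "('a::complex_hilbert_space \<Rightarrow> 'a) \<Rightarrow> 'a \<Rightarrow> 'a" where
  "mp_inverse T = (THE X. is_mp_inverse T X)"

definition op_spectrum :: "('a::complex_hilbert_space \<Rightarrow> 'a) \<Rightarrow> complex set" where
  "op_spectrum A =
     {\<mu>. \<not> (\<exists>B. bounded_clinear B \<and>
               (\<forall>x. B (\<mu> *\<^sub>C x - A x) = x) \<and> (\<forall>x. \<mu> *\<^sub>C B x - A (B x) = x))}"

text \<open>
  The spectrum of a bounded operator is empty only on the zero space, where the spectral radius is
  taken to be 0 (the real supremum of the empty set being unspecified).
\<close>

definition op_spectral_radius :: "('a::complex_hilbert_space \<Rightarrow> 'a) \<Rightarrow> real" where
  "op_spectral_radius A =
     (if op_spectrum A = {} then 0 else (SUP \<mu>\<in>op_spectrum A. cmod \<mu>))"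

end

theory Submission
  imports Defs
begin

text \<open>
  Put \<open>W = T\<^sup>\<dagger>V\<close> and \<open>A = U\<^sup>\<dagger>V\<close>.  Both \<open>W x\<close> and \<open>A x + W (A x)\<close> lie in the orthogonal complement of the
  common nullspace, and \<open>T\<close> sends both to \<open>V x\<close>, so \<open>(I + W) A = W\<close>.  Hence \<open>\<mu> \<mapsto> \<mu>/(1 - \<mu>)\<close> carries the
  spectrum of \<open>A\<close> onto that of \<open>W\<close>.  The latter lies in \<open>[0, \<infinity>)\<close> because \<open>\<mu> - W\<close> is coercive for every
  other \<open>\<mu>\<close>, and \<open>t \<mapsto> t/(1 + t)\<close> is continuous and increasing there, hence commutes with suprema.
\<close>

subsection \<open>Elementary facts on complex Hilbert spaces\<close>

lemma cinner_add_right: "cinner x (y + z) = cinner x y + cinner x z"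
  by (metis cinner_add_left cinner_commute complex_cnj_add)

lemma cinner_scaleC_right: "cinner x (c *\<^sub>C y) = cnj c * cinner x y"
  by (metis cinner_commute cinner_scaleC_left complex_cnj_mult)

lemma zero_scaleC [simp]: "0 *\<^sub>C (x::'a::complex_hilbert_space) = 0"
  using scaleC_add_left[of 0 0 x] by simp

lemma minus_scaleC: "(- c) *\<^sub>C x = - (c *\<^sub>C (x::'a::complex_hilbert_space))"
  using scaleC_add_left[of "- c" c x] by (simp add: eq_neg_iff_add_eq_0)

lemma scaleC_diff_left: "(c - d) *\<^sub>C x = c *\<^sub>C x - d *\<^sub>C (x::'a::complex_hilbert_space)"
  by (metis add_diff_cancel_right' diff_add_cancel scaleC_add_left)

lemma scaleC_diff_right: "c *\<^sub>C (x - y) = c *\<^sub>C x - c *\<^sub>C (y::'a::complex_hilbert_space)"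
  by (metis add_diff_cancel_right' diff_add_cancel scaleC_add_right)

lemma cinner_diff_left: "cinner (x - y) z = cinner x z - cinner y z"
  by (metis add_diff_cancel_right' cinner_add_left diff_add_cancel)

lemma cinner_diff_right: "cinner x (y - z) = cinner x y - cinner x z"
  by (metis add_diff_cancel_right' cinner_add_right diff_add_cancel)

lemma cinner_zero_left [simp]: "cinner 0 x = 0"
  using cinner_add_left[of 0 0 x] by simp

lemma cinner_zero_right [simp]: "cinner x 0 = 0"
  using cinner_add_right[of x 0 0] by simp

lemma cinner_self: "cinner x x = complex_of_real ((norm x)\<^sup>2)"
proof -
  have "Im (cinner x x) = 0"
    using cinner_commute[of x x] by (metis Reals_cnj_iff complex_is_Real_iff)
  moreover have "Re (cinner x x) = (norm x)\<^sup>2"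
    by (simp add: inner_eq_Re_cinner[symmetric] power2_norm_eq_inner)
  ultimately show ?thesis by (simp add: complex_eq_iff)
qed

lemma cinner_self_eq_zero [simp]: "cinner x x = 0 \<longleftrightarrow> x = 0"
  by (simp add: cinner_self)

lemma norm_scaleC: "norm (c *\<^sub>C x) = cmod c * norm (x::'a::complex_hilbert_space)"
proof -
  have "cinner (c *\<^sub>C x) (c *\<^sub>C x) = (c * cnj c) * cinner x x"
    by (simp add: cinner_scaleC_left cinner_scaleC_right)
  then have "complex_of_real ((norm (c *\<^sub>C x))\<^sup>2) = complex_of_real ((cmod c * norm x)\<^sup>2)"
    by (simp add: cinner_self power_mult_distrib flip: complex_norm_square)
  then have "(norm (c *\<^sub>C x))\<^sup>2 = (cmod c * norm x)\<^sup>2"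
    using of_real_eq_iff by blast
  then show ?thesis by (simp add: power2_eq_iff_nonneg)
qed

text \<open>Rotating \<open>x\<close> by a unimodular \<open>c\<close> makes the inner product real
  and nonnegative; it then agrees with the real \<open>inner\<close>, whose Cauchy-Schwarz
  inequality applies.\<close>

lemma norm_cinner_le: "cmod (cinner x y) \<le> norm x * norm y"
proof -
  obtain c where c: "cmod c = 1" "c * cinner x y = complex_of_real (cmod (cinner x y))"
  proof (cases "cinner x y = 0")
    case False
    show ?thesis
    proof (rule that[of "cnj (cinner x y) / cmod (cinner x y)"])
      show "cmod (cnj (cinner x y) / complex_of_real (cmod (cinner x y))) = 1"
        using False by (simp add: norm_divide)
      show "cnj (cinner x y) / complex_of_real (cmod (cinner x y)) * cinner x y
              = complex_of_real (cmod (cinner x y))"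
        using False complex_norm_square[of "cinner x y"]
        by (simp add: field_simps power2_eq_square)
    qed
  qed (use that[of 1] in simp)
  have "cmod (cinner x y) = Re (cinner (c *\<^sub>C x) y)"
    by (simp add: cinner_scaleC_left c)
  also have "\<dots> = inner (c *\<^sub>C x) y"
    by (simp add: inner_eq_Re_cinner)
  also have "\<dots> \<le> norm x * norm y"
    using norm_cauchy_schwarz[of "c *\<^sub>C x" y] by (simp add: norm_scaleC c)
  finally show ?thesis .
qed

lemma bounded_linear_scaleC: "bounded_linear (\<lambda>x::'a::complex_hilbert_space. c *\<^sub>C x)"
  by (rule bounded_linear_intro[where K = "cmod c"])
    (auto simp: scaleC_add_right scaleR_scaleC scaleC_scaleC norm_scaleC mult.commute)

lemma bounded_linear_cinner_left: "bounded_linear (\<lambda>x. cinner x y)"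
  by (rule bounded_linear_intro[where K = "norm y"])
    (auto simp: cinner_add_left scaleR_scaleC cinner_scaleC_left norm_cinner_le scaleR_conv_of_real)

section \<open>Complex subspaces and their closures\<close>

definition complex_subspace :: "'a::complex_hilbert_space set \<Rightarrow> bool" where
  "complex_subspace M \<longleftrightarrow>
     0 \<in> M \<and> (\<forall>x\<in>M. \<forall>y\<in>M. x + y \<in> M) \<and> (\<forall>c. \<forall>x\<in>M. c *\<^sub>C x \<in> M)"

lemma complex_subspaceD:
  assumes "complex_subspace M"
  shows "0 \<in> M" "x \<in> M \<Longrightarrow> y \<in> M \<Longrightarrow> x + y \<in> M" "x \<in> M \<Longrightarrow> c *\<^sub>C x \<in> M"
    "x \<in> M \<Longrightarrow> y \<in> M \<Longrightarrow> x - y \<in> M"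
proof -
  show *: "0 \<in> M" "x \<in> M \<Longrightarrow> y \<in> M \<Longrightarrow> x + y \<in> M" "x \<in> M \<Longrightarrow> c *\<^sub>C x \<in> M" for c x y
    using assms unfolding complex_subspace_def by auto
  show "x \<in> M \<Longrightarrow> y \<in> M \<Longrightarrow> x - y \<in> M"
    using *(2)[of x "(-1) *\<^sub>C y"] *(3)[of y "-1"] by (simp add: minus_scaleC scaleC_one)
qed

lemma complex_subspace_imp_subspace:
  assumes "complex_subspace M"
  shows "subspace M"
  using complex_subspaceD[OF assms] by (simp add: subspace_def scaleR_scaleC)

lemma complex_subspace_closure:
  assumes "complex_subspace M"
  shows "complex_subspace (closure M)"
  unfolding complex_subspace_def
proof (intro conjI allI ballI)
  show "0 \<in> closure M"
    using complex_subspaceD(1)[OF assms] closure_subset by blast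
next
  fix x y assume "x \<in> closure M" "y \<in> closure M"
  then obtain f g where "\<forall>n. f n \<in> M" "f \<longlonglongrightarrow> x" "\<forall>n. g n \<in> M" "g \<longlonglongrightarrow> y"
    unfolding closure_sequential by blast
  then show "x + y \<in> closure M"
    unfolding closure_sequential
    by (intro exI[of _ "\<lambda>n. f n + g n"]) (auto intro: tendsto_add complex_subspaceD[OF assms])
next
  fix c x assume "x \<in> closure M"
  then obtain f where "\<forall>n. f n \<in> M" "f \<longlonglongrightarrow> x"
    unfolding closure_sequential by blast
  then show "c *\<^sub>C x \<in> closure M"
    unfolding closure_sequential
    by (intro exI[of _ "\<lambda>n. c *\<^sub>C f n"])
      (auto intro: complex_subspaceD[OF assms] bounded_linear.tendsto[OF bounded_linear_scaleC])
qed

section \<open>Bounded complex-linear operators and orthogonal complements\<close>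

lemma bounded_clinearD:
  assumes "bounded_clinear A"
  shows "bounded_linear A" "A (x + y) = A x + A y" "A (x - y) = A x - A y"
    "A (c *\<^sub>C x) = c *\<^sub>C A x" "A 0 = 0"
  using assms unfolding bounded_clinear_def
  by (auto simp: linear_simps)

lemma bounded_clinear_intro:
  assumes "\<And>x y. A (x + y) = A x + A y" "\<And>c x. A (c *\<^sub>C x) = c *\<^sub>C A x"
    "\<And>x. norm (A x) \<le> norm x * K"
  shows "bounded_clinear A"
  unfolding bounded_clinear_def
  using assms by (auto intro!: bounded_linear_intro[where K = K] simp: scaleR_scaleC)

lemma bounded_clinear_compose:
  assumes "bounded_clinear A" "bounded_clinear B"
  shows "bounded_clinear (\<lambda>x. A (B x))"
  using assms unfolding bounded_clinear_def by (auto intro: bounded_linear_compose)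

lemma complex_subspace_range:
  assumes "\<And>x y. A (x + y) = A x + A y" "\<And>c x. A (c *\<^sub>C x) = c *\<^sub>C A x"
  shows "complex_subspace (range A)"
  unfolding complex_subspace_def
proof (intro conjI allI ballI)
  show "0 \<in> range A"
    using assms(2)[of 0 0] by (simp add: range_eqI[of _ _ 0])
qed (auto simp: assms(1)[symmetric] assms(2)[symmetric])

text \<open>The inner product is continuous, so orthogonality passes to limits. This links ranges
  that may fail to be closed with the closed subspaces on which projections exist.\<close>

lemma ortho_compl_closure: "ortho_compl (closure M) = ortho_compl M"
proof (intro equalityI subsetI)
  show "x \<in> ortho_compl M" if "x \<in> ortho_compl (closure M)" for x
    using that closure_subset unfolding ortho_compl_def by blast
next
  fix x assume x: "x \<in> ortho_compl M"
  have "cinner y x = 0" if y: "y \<in> closure M" for y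
  proof -
    obtain f where f: "\<forall>n. f n \<in> M" "f \<longlonglongrightarrow> y"
      using y unfolding closure_sequential by blast
    have "(\<lambda>n. cinner (f n) x) \<longlonglongrightarrow> cinner y x"
      using bounded_linear.tendsto[OF bounded_linear_cinner_left f(2)] .
    moreover have "cinner (f n) x = 0" for n
      using x f(1) cinner_commute[of "f n" x] by (simp add: ortho_compl_def)
    ultimately show ?thesis by (simp add: LIMSEQ_const_iff)
  qed
  then show "x \<in> ortho_compl (closure M)"
    unfolding ortho_compl_def using cinner_commute[of x] by simp
qed

lemma complex_subspace_ortho_compl: "complex_subspace (ortho_compl M)"
  by (auto simp: complex_subspace_def ortho_compl_def cinner_add_left cinner_scaleC_left)

lemma ortho_compl_disjoint:
  assumes "x \<in> M" "x \<in> ortho_compl M"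
  shows "x = 0"
  using assms cinner_self_eq_zero[of x] unfolding ortho_compl_def by blast

subsection \<open>Orthogonal projections\<close>

text \<open>The space may be infinite-dimensional, so the minimum is reached through completeness
  instead of compactness: a minimising sequence converges.\<close>

lemma ex_closest_point_subspace:
  fixes S :: "'a::{real_inner,complete_space} set"
  assumes S: "subspace S" "closed S"
  obtains y where "y \<in> S" "\<And>z. z \<in> S \<Longrightarrow> norm (x - y) \<le> norm (x - z)"
proof -
  define D where "D = (INF z\<in>S. (norm (x - z))\<^sup>2)"
  have "0 \<in> S" using S(1) by (rule subspace_0)
  have bdd: "bdd_below ((\<lambda>z. (norm (x - z))\<^sup>2) ` S)"
    by (rule bdd_belowI2[of _ 0]) simp
  have D_le: "D \<le> (norm (x - z))\<^sup>2" if "z \<in> S" for z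
    unfolding D_def by (rule cINF_lower[OF bdd that])
  have "\<exists>z\<in>S. (norm (x - z))\<^sup>2 < D + inverse (Suc n)" for n :: nat
    unfolding D_def
    by (subst cINF_less_iff[OF _ bdd, symmetric]) (use \<open>0 \<in> S\<close> in auto)
  then obtain y where y: "\<And>n. y n \<in> S" "\<And>n::nat. (norm (x - y n))\<^sup>2 < D + inverse (Suc n)"
    by metis
  \<comment> \<open>Parallelogram law: a minimising sequence is Cauchy because the midpoints stay in \<open>S\<close>.\<close>
  have dist_y: "(norm (y n - y m))\<^sup>2 \<le> 2 * inverse (Suc n) + 2 * inverse (Suc m)" for n m
  proof -
    have "(1/2) *\<^sub>R (y n + y m) \<in> S"
      using S(1) y(1) by (intro subspace_scale subspace_add)
    from D_le[OF this] have D: "4 * D \<le> 4 * (norm (x - (1/2) *\<^sub>R (y n + y m)))\<^sup>2"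
      by simp
    have "(norm (y n - y m))\<^sup>2 + 4 * (norm (x - (1/2) *\<^sub>R (y n + y m)))\<^sup>2
        = 2 * (norm (x - y n))\<^sup>2 + 2 * (norm (x - y m))\<^sup>2"
      by (simp add: power2_norm_eq_inner inner_simps inner_commute algebra_simps)
    with D y(2)[of n] y(2)[of m] show ?thesis by linarith
  qed
  have "Cauchy y"
  proof (rule CauchyI)
    fix e :: real assume "0 < e"
    \<comment> \<open>From \<open>N\<close> on, squared distances are at most
      \<open>4 * inverse (Suc N)\<close>, hence the bound \<open>e\<^sup>2 / 4\<close>.\<close>
    then obtain N where N: "inverse (real (Suc N)) < e\<^sup>2 / 4"
      using reals_Archimedean[of "e\<^sup>2 / 4"] by auto
    have "norm (y m - y n) < e" if "m \<ge> N" "n \<ge> N" for m n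
    proof -
      have "inverse (real (Suc m)) \<le> inverse (real (Suc N))" "inverse (real (Suc n)) \<le> inverse (real (Suc N))"
        using that by auto
      then have "(norm (y m - y n))\<^sup>2 < e\<^sup>2"
        using dist_y[of m n] N by linarith
      then show ?thesis
        using \<open>0 < e\<close> by (simp add: power_less_imp_less_base)
    qed
    then show "\<exists>M. \<forall>m\<ge>M. \<forall>n\<ge>M. norm (y m - y n) < e" by blast
  qed
  then obtain l where l: "y \<longlonglongrightarrow> l"
    using Cauchy_convergent convergent_def by blast
  have "(\<lambda>n. (norm (x - y n))\<^sup>2) \<longlonglongrightarrow> (norm (x - l))\<^sup>2"
    by (intro tendsto_intros l)
  moreover have "(\<lambda>n. D + inverse (real (Suc n))) \<longlonglongrightarrow> D"
    by (rule LIMSEQ_inverse_real_of_nat_add)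
  ultimately have le_D: "(norm (x - l))\<^sup>2 \<le> D"
    by (rule LIMSEQ_le) (use y(2) in \<open>auto intro: less_imp_le\<close>)
  show thesis
  proof
    show "l \<in> S"
      using closed_sequentially[OF S(2)] y(1) l by blast
    show "norm (x - l) \<le> norm (x - z)" if "z \<in> S" for z
      by (rule power2_le_imp_le[OF order_trans[OF le_D D_le[OF that]]]) simp
  qed
qed

lemma ex_orthogonal_decomposition:
  assumes M: "complex_subspace M" "closed M"
  obtains y where "y \<in> M" "x - y \<in> ortho_compl M"
proof -
  obtain y where y: "y \<in> M" "\<And>z. z \<in> M \<Longrightarrow> norm (x - y) \<le> norm (x - z)"
    using ex_closest_point_subspace[OF complex_subspace_imp_subspace[OF M(1)] M(2)] by metis
  have inner0: "inner (x - y) m = 0" if "m \<in> M" for m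
  proof (cases "m = 0")
    case False
    \<comment> \<open>This \<open>t\<close> minimises the squared norm of
      \<open>x - y - t *\<^sub>R m\<close>; minimality of \<open>y\<close> then forces the linear
      coefficient to vanish.\<close>
    define t where "t = inner (x - y) m / (norm m)\<^sup>2"
    have "y + t *\<^sub>R m \<in> M"
      by (simp add: scaleR_scaleC complex_subspaceD[OF M(1)] y(1) that)
    from y(2)[OF this] have "inner (x - y) (x - y) \<le> inner (x - y - t *\<^sub>R m) (x - y - t *\<^sub>R m)"
      by (simp add: norm_le diff_diff_eq)
    also have "\<dots> = inner (x - y) (x - y) - 2 * t * inner (x - y) m + t\<^sup>2 * (norm m)\<^sup>2"
      unfolding power2_norm_eq_inner
      by (simp add: inner_simps inner_commute power2_eq_square algebra_simps)
    also have "t\<^sup>2 * (norm m)\<^sup>2 = t * inner (x - y) m"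
      using False by (simp add: t_def power2_eq_square)
    finally have "t * inner (x - y) m \<le> 0" by linarith
    then show ?thesis
      using False by (simp add: t_def divide_le_0_iff mult_le_0_iff)
        (metis less_eq_real_def not_less)
  qed simp
  \<comment> \<open>Real orthogonality to \<open>m\<close> kills the real part, and to
    \<open>\<i> *\<^sub>C m\<close>, again in \<open>M\<close>, the imaginary part.\<close>
  have "cinner (x - y) m = 0" if "m \<in> M" for m
  proof -
    have "Re (cinner (x - y) m) = 0"
      using inner0[OF that] by (simp add: inner_eq_Re_cinner)
    moreover have "Re (cinner (x - y) (\<i> *\<^sub>C m)) = 0"
      using inner0[OF complex_subspaceD(3)[OF M(1) that]] by (simp add: inner_eq_Re_cinner)
    ultimately show ?thesis
      by (simp add: cinner_scaleC_right complex_eq_iff)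
  qed
  then show thesis
    using that y(1) by (simp add: ortho_compl_def)
qed

lemma orthogonal_decomposition_unique:
  assumes M: "complex_subspace M" and "y \<in> M" "x - y \<in> ortho_compl M" "z \<in> M" "x - z \<in> ortho_compl M"
  shows "y = z"
proof -
  have "y - z \<in> M"
    using complex_subspaceD(4)[OF M] assms by blast
  moreover have "y - z \<in> ortho_compl M"
    using complex_subspaceD(4)[OF complex_subspace_ortho_compl assms(5,3)] by simp
  ultimately show ?thesis
    using ortho_compl_disjoint by fastforce
qed

lemma orth_proj_eqI:
  assumes "complex_subspace M" "y \<in> M" "x - y \<in> ortho_compl M"
  shows "orth_proj M x = y"
  unfolding orth_proj_def
  using assms orthogonal_decomposition_unique by (intro the_equality) blast+

lemma orth_proj:
  assumes "complex_subspace M" "closed M"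
  shows "orth_proj M x \<in> M" "x - orth_proj M x \<in> ortho_compl M"
  using ex_orthogonal_decomposition[OF assms, of x] orth_proj_eqI[OF assms(1)] by metis+

subsection \<open>Adjoints\<close>

text \<open>For nonzero \<open>f\<close> the kernel is a proper closed subspace; a nonzero
  \<open>z\<close> orthogonal to it represents \<open>f\<close> up to a scalar.\<close>

lemma riesz_representation:
  assumes f: "bounded_linear f" and f_scale: "\<And>c x. f (c *\<^sub>C x) = c * f x"
  obtains y where "\<And>x. f x = cinner x y"
proof (cases "\<forall>x. f x = 0")
  case True
  then show thesis using that[of 0] by simp
next
  case False
  then obtain x0 where x0: "f x0 \<noteq> 0" by blast
  let ?K = "{x. f x = 0}"
  have "complex_subspace ?K"
    using f_scale by (auto simp: complex_subspace_def linear_simps[OF f])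
  moreover have "closed ?K"
    using f by (intro closed_Collect_eq continuous_intros)
      (simp_all add: linear_continuous_on)
  ultimately obtain k where k: "f k = 0" "x0 - k \<in> ortho_compl ?K"
    using ex_orthogonal_decomposition[of ?K x0] by blast
  define z where "z = x0 - k"
  have fz: "f z \<noteq> 0"
    using x0 k by (simp add: z_def linear_simps[OF f])
  then have "z \<noteq> 0"
    using linear_simps(3)[OF f] by metis
  have "f x = cinner x (cnj (f z / cinner z z) *\<^sub>C z)" for x
  proof -
    \<comment> \<open>The combination is built so that \<open>f\<close> cancels; pairing it with
      \<open>z\<close> gives \<open>f z * cinner x z = f x * cinner z z\<close>.\<close>
    have "f z *\<^sub>C x - f x *\<^sub>C z \<in> ?K"
      by (simp add: linear_simps[OF f] f_scale)
    then have "cinner z (f z *\<^sub>C x - f x *\<^sub>C z) = 0"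
      using k(2) unfolding z_def[symmetric] ortho_compl_def by blast
    then have "cinner (f z *\<^sub>C x - f x *\<^sub>C z) z = 0"
      by (metis cinner_commute complex_cnj_zero)
    then show ?thesis
      using \<open>z \<noteq> 0\<close> by (simp add: cinner_diff_left cinner_scaleC_left cinner_scaleC_right field_simps)
  qed
  then show thesis by (rule that)
qed

lemma cinner_left_eqI:
  assumes "\<And>x. cinner x u = cinner x v"
  shows "u = v"
proof -
  have "cinner (u - v) (u - v) = 0"
    using assms by (simp only: cinner_diff_right) simp
  then show ?thesis by simp
qed

text \<open>\<open>cadjoint\<close> is a definite description that must be shown to denote: Riesz
  representation supplies existence, nondegeneracy of the inner product uniqueness.\<close>

lemma cinner_cadjoint:
  assumes A: "bounded_clinear A"
  shows "cinner (A x) y = cinner x (cadjoint A y)"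
proof -
  have "\<exists>z. \<forall>x. cinner (A x) y = cinner x z" for y
  proof -
    have "bounded_linear (\<lambda>x. cinner (A x) y)"
      using bounded_linear_compose[OF bounded_linear_cinner_left bounded_clinearD(1)[OF A]] .
    then show ?thesis
      using riesz_representation[of "\<lambda>x. cinner (A x) y"]
      by (metis bounded_clinearD(4)[OF A] cinner_scaleC_left)
  qed
  then obtain B where B: "\<forall>x y. cinner (A x) y = cinner x (B y)" by metis
  have "cadjoint A = B"
    unfolding cadjoint_def
  proof (rule the_equality)
    show "\<forall>x y. cinner (A x) y = cinner x (B y)" by (rule B)
  next
    fix C assume "\<forall>x y. cinner (A x) y = cinner x (C y)"
    then show "C = B"
      using B by (intro ext cinner_left_eqI) metis
  qed
  then show ?thesis using B by blast
qed

lemma complex_subspace_range_cadjoint: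
  assumes A: "bounded_clinear A"
  shows "complex_subspace (range (cadjoint A))"
proof (rule complex_subspace_range)
  show "cadjoint A (x + y) = cadjoint A x + cadjoint A y" for x y
    by (rule cinner_left_eqI) (simp add: cinner_cadjoint[OF A, symmetric] cinner_add_right)
  show "cadjoint A (c *\<^sub>C x) = c *\<^sub>C cadjoint A x" for c x
    by (rule cinner_left_eqI) (simp add: cinner_cadjoint[OF A, symmetric] cinner_scaleC_right)
qed

lemma ortho_compl_range_cadjoint:
  assumes A: "bounded_clinear A"
  shows "ortho_compl (range (cadjoint A)) = nullspace A"
proof -
  have "(\<forall>y. cinner (A x) y = 0) \<longleftrightarrow> A x = 0" for x
    by (metis cinner_self_eq_zero cinner_zero_left)
  then show ?thesis
    by (auto simp: ortho_compl_def nullspace_def cinner_cadjoint[OF A])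
qed

subsection \<open>The Moore-Penrose inverse\<close>

text \<open>The range of the adjoint need not be closed; its closure is the space that
  \<open>X A\<close> projects onto in \<open>is_mp_inverse\<close>.\<close>

definition initial_space :: "('a::complex_hilbert_space \<Rightarrow> 'a) \<Rightarrow> 'a set" where
  "initial_space A = closure (range (cadjoint A))"

lemma initial_space:
  assumes A: "bounded_clinear A"
  shows "complex_subspace (initial_space A)" "closed (initial_space A)"
    "ortho_compl (initial_space A) = nullspace A"
  by (simp_all add: initial_space_def complex_subspace_closure complex_subspace_range_cadjoint
      ortho_compl_closure ortho_compl_range_cadjoint A)

text \<open>The part of \<open>x\<close> that the projection discards is orthogonal to the initial
  space, hence in the nullspace, so \<open>A\<close> does not see it.\<close>

lemma orth_proj_initial_space:
  assumes A: "bounded_clinear A"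
  shows "orth_proj (initial_space A) x \<in> initial_space A" "A (orth_proj (initial_space A) x) = A x"
proof -
  show "orth_proj (initial_space A) x \<in> initial_space A"
    using orth_proj(1) initial_space[OF A] by blast
  have "x - orth_proj (initial_space A) x \<in> nullspace A"
    using orth_proj(2)[of "initial_space A" x] initial_space[OF A] by simp
  then show "A (orth_proj (initial_space A) x) = A x"
    by (simp add: nullspace_def bounded_clinearD(3)[OF A])
qed

lemma initial_space_subset:
  assumes A: "bounded_clinear A"
  shows "initial_space A \<subseteq> ortho_compl (nullspace A)"
proof
  fix x assume x: "x \<in> initial_space A"
  have "cinner x y = 0" if "y \<in> nullspace A" for y
  proof -
    have "cinner y x = 0"
      using that x unfolding initial_space(3)[OF A, symmetric] ortho_compl_def by blast
    then show ?thesis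
      by (metis cinner_commute complex_cnj_zero)
  qed
  then show "x \<in> ortho_compl (nullspace A)" by (simp add: ortho_compl_def)
qed

text \<open>The difference of two points with equal images lies in the nullspace and in its
  complement. Equations between elements of the complement can thus be checked after applying
  \<open>A\<close>.\<close>

lemma inj_on_ortho_compl_nullspace:
  assumes A: "bounded_clinear A"
  shows "inj_on A (ortho_compl (nullspace A))"
proof (rule inj_onI)
  fix x y assume xy: "x \<in> ortho_compl (nullspace A)" "y \<in> ortho_compl (nullspace A)" "A x = A y"
  have "x - y \<in> ortho_compl (nullspace A)"
    using xy complex_subspaceD(4)[OF complex_subspace_ortho_compl] by blast
  moreover have "x - y \<in> nullspace A"
    using xy by (simp add: nullspace_def bounded_clinearD(3)[OF A])
  ultimately show "x = y"
    using ortho_compl_disjoint by fastforce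
qed

lemma mp_domain_iff:
  "z \<in> mp_domain A \<longleftrightarrow> (\<exists>x. z - A x \<in> ortho_compl (range A))"
proof
  assume "z \<in> mp_domain A"
  then obtain x w where "z = A x + w" "w \<in> ortho_compl (range A)"
    unfolding mp_domain_def by blast
  then show "\<exists>x. z - A x \<in> ortho_compl (range A)"
    by (intro exI[of _ x]) simp
next
  assume "\<exists>x. z - A x \<in> ortho_compl (range A)"
  then obtain x where "z - A x \<in> ortho_compl (range A)" ..
  then show "z \<in> mp_domain A"
    unfolding mp_domain_def by (intro CollectI exI[of _ "A x"] exI[of _ "z - A x"]) auto
qed

text \<open>The value at \<open>z\<close> is the unique \<open>x\<close> in the initial space whose
  residual \<open>z - A x\<close> is orthogonal to the range: the least-squares solution of minimal
  norm. Most laws then follow through \<open>XI\<close>, by checking that the proposed value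
  qualifies.\<close>

lemma ex_is_mp_inverse:
  assumes A: "bounded_clinear A"
  obtains X where "is_mp_inverse A X"
proof -
  note A_simps = bounded_clinearD[OF A]
  let ?M = "initial_space A" and ?N = "ortho_compl (range A)" and ?P = "orth_proj (initial_space A)"
  note N = complex_subspaceD[OF complex_subspace_ortho_compl[of "range A"]]
  note M = complex_subspaceD[OF initial_space(1)[OF A]]
  have unique: "x = y" if "x \<in> ?M" "y \<in> ?M" "z - A x \<in> ?N" "z - A y \<in> ?N" for x y z
  proof (rule inj_onD[OF inj_on_ortho_compl_nullspace[OF A]])
    \<comment> \<open>The difference of the two residuals lies in the range and in its complement,
      so it vanishes.\<close>
    have "A (x - y) \<in> ?N"
      using N(4)[OF that(4,3)] by (simp add: A_simps)
    then have "A (x - y) = 0"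
      by (rule ortho_compl_disjoint[OF rangeI])
    then show "A x = A y" by (simp add: A_simps)
    show "x \<in> ortho_compl (nullspace A)" "y \<in> ortho_compl (nullspace A)"
      using initial_space_subset[OF A] that(1,2) by blast+
  qed
  have "\<exists>x\<in>?M. z - A x \<in> ?N" if "z \<in> mp_domain A" for z
    using that orth_proj_initial_space[OF A] unfolding mp_domain_iff by metis
  then obtain X0 where X0: "\<And>z. z \<in> mp_domain A \<Longrightarrow> X0 z \<in> ?M \<and> z - A (X0 z) \<in> ?N"
    by metis
  define X where "X z = (if z \<in> mp_domain A then X0 z else 0)" for z
  have X: "X z \<in> ?M" "z - A (X z) \<in> ?N" if "z \<in> mp_domain A" for z
    using X0[OF that] that by (simp_all add: X_def)
  have XI: "X z = x" if "x \<in> ?M" "z - A x \<in> ?N" for x z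
  proof -
    have "z \<in> mp_domain A"
      using that(2) mp_domain_iff by blast
    then show ?thesis
      using unique X that by blast
  qed
  have X_A: "X (A x) = ?P x" for x
    by (rule XI) (simp_all add: orth_proj_initial_space[OF A] N(1))
  have "is_mp_inverse A X"
    unfolding is_mp_inverse_def initial_space_def[symmetric]
  proof (intro conjI ballI allI impI)
    fix x y assume xy: "x \<in> mp_domain A" "y \<in> mp_domain A"
    have "x + y - A (X x + X y) = (x - A (X x)) + (y - A (X y))"
      by (simp add: A_simps)
    then show "X (x + y) = X x + X y"
      using X[OF xy(1)] X[OF xy(2)] M(2) N(2) by (intro XI) metis+
  next
    fix c x assume x: "x \<in> mp_domain A"
    have "c *\<^sub>C x - A (c *\<^sub>C X x) = c *\<^sub>C (x - A (X x))"
      by (simp add: A_simps scaleC_diff_right)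
    then show "X (c *\<^sub>C x) = c *\<^sub>C X x"
      using X[OF x] M(3) N(3) by (intro XI) metis+
  next
    show "A (X (A x)) = A x" for x
      by (simp add: X_A orth_proj_initial_space[OF A])
  next
    show "X (A (X x)) = X x" if "x \<in> mp_domain A" for x
      by (rule XI) (simp_all add: X[OF that] N(1))
  next
    show "X (A x) = ?P x" for x by (rule X_A)
  next
    fix x assume x: "x \<in> mp_domain A"
    have "A (X x) \<in> closure (range A)"
      by (rule subsetD[OF closure_subset rangeI])
    moreover have "complex_subspace (closure (range A))"
      by (intro complex_subspace_closure complex_subspace_range A_simps)
    ultimately show "A (X x) = orth_proj (closure (range A)) x"
      using X(2)[OF x] by (intro orth_proj_eqI[symmetric]) (simp_all add: ortho_compl_closure)
  next
    show "X x = 0" if "x \<notin> mp_domain A" for x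
      using that by (simp add: X_def)
  qed
  then show thesis by (rule that)
qed

text \<open>\<open>X A = Y A\<close>, and \<open>A X = A Y\<close> on the domain, being the same
  projections. So \<open>X = X A X = Y A X = Y A Y = Y\<close> there, and both are 0
  elsewhere.\<close>

lemma is_mp_inverse_unique:
  assumes X: "is_mp_inverse A X" and Y: "is_mp_inverse A Y"
  shows "X = Y"
proof
  fix z
  show "X z = Y z"
  proof (cases "z \<in> mp_domain A")
    case True
    have "X (A x) = Y (A x)" for x
      using X Y unfolding is_mp_inverse_def by metis
    moreover have "A (X z) = A (Y z)" "X (A (X z)) = X z" "Y (A (Y z)) = Y z"
      using X Y True unfolding is_mp_inverse_def by metis+
    ultimately show ?thesis by metis
  next
    case False
    then show ?thesis
      using X Y unfolding is_mp_inverse_def by simp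
  qed
qed

lemma is_mp_inverse_mp_inverse:
  assumes "bounded_clinear A"
  shows "is_mp_inverse A (mp_inverse A)"
  unfolding mp_inverse_def
  by (metis theI ex_is_mp_inverse[OF assms] is_mp_inverse_unique)

text \<open>For \<open>z = A x\<close> the inverse returns the projection of \<open>x\<close> to the
  initial space. The two facts determine the value, since \<open>A\<close> is injective on that
  complement; the splitting argument rests on them.\<close>

lemma mp_inverse_range:
  assumes A: "bounded_clinear A" and "z \<in> range A"
  shows "mp_inverse A z \<in> ortho_compl (nullspace A)" "A (mp_inverse A z) = z"
proof -
  obtain x where z: "z = A x" using assms(2) by blast
  have "mp_inverse A (A x) = orth_proj (initial_space A) x"
    using is_mp_inverse_mp_inverse[OF A] unfolding is_mp_inverse_def initial_space_def by blast
  then show "mp_inverse A z \<in> ortho_compl (nullspace A)" "A (mp_inverse A z) = z"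
    using orth_proj_initial_space[OF A] initial_space_subset[OF A] z by auto
qed

subsection \<open>Invertible operators\<close>

text \<open>The condition inside \<open>op_spectrum\<close>, with boundedness of the inverse built
  in and nothing asked of \<open>S\<close> itself, so that it applies to \<open>\<mu> - A\<close>
  without a separate boundedness proof for \<open>A\<close>.\<close>

definition bounded_invertible :: "('a::complex_hilbert_space \<Rightarrow> 'a) \<Rightarrow> bool" where
  "bounded_invertible S \<longleftrightarrow>
     (\<exists>B. bounded_clinear B \<and> (\<forall>x. B (S x) = x) \<and> (\<forall>x. S (B x) = x))"

lemma op_spectrum_iff: "\<mu> \<in> op_spectrum A \<longleftrightarrow> \<not> bounded_invertible (\<lambda>x. \<mu> *\<^sub>C x - A x)"
  by (simp add: op_spectrum_def bounded_invertible_def)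

lemma bounded_invertible_compose:
  assumes "bounded_invertible R" "bounded_invertible S"
  shows "bounded_invertible (\<lambda>x. R (S x))"
proof -
  obtain R' S' where "bounded_clinear R'" "\<And>x. R' (R x) = x" "\<And>x. R (R' x) = x"
    "bounded_clinear S'" "\<And>x. S' (S x) = x" "\<And>x. S (S' x) = x"
    using assms unfolding bounded_invertible_def by metis
  then show ?thesis
    unfolding bounded_invertible_def
    by (intro exI[of _ "\<lambda>x. S' (R' x)"]) (simp add: bounded_clinear_compose)
qed

text \<open>The inverse of \<open>R\<close> is itself invertible, with inverse \<open>R\<close>, and
  composing with it cancels \<open>R\<close>. This carries invertibility through factorisations
  involving \<open>\<mu> - A\<close>.\<close>

lemma bounded_invertible_compose_iff:
  assumes R: "bounded_invertible R" "bounded_clinear R"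
  shows "bounded_invertible (\<lambda>x. R (S x)) \<longleftrightarrow> bounded_invertible S"
proof
  obtain R' where R': "bounded_clinear R'" "\<And>x. R' (R x) = x" "\<And>x. R (R' x) = x"
    using R unfolding bounded_invertible_def by metis
  then have "bounded_invertible R'"
    using R(2) unfolding bounded_invertible_def by blast
  moreover assume "bounded_invertible (\<lambda>x. R (S x))"
  ultimately have "bounded_invertible (\<lambda>x. R' (R (S x)))"
    by (rule bounded_invertible_compose)
  then show "bounded_invertible S" by (simp add: R')
qed (rule bounded_invertible_compose[OF R(1)])

lemma bounded_clinear_scaleC: "bounded_clinear (\<lambda>x. c *\<^sub>C x)"
  by (simp add: bounded_clinear_def bounded_linear_scaleC scaleC_scaleC mult.commute)

lemma bounded_invertible_scaleC:
  assumes "c \<noteq> 0"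
  shows "bounded_invertible (\<lambda>x. c *\<^sub>C x)"
  unfolding bounded_invertible_def using assms
  by (intro exI[of _ "\<lambda>x. inverse c *\<^sub>C x"])
    (simp add: scaleC_scaleC scaleC_one bounded_clinear_scaleC)

lemma bounded_clinear_diff:
  assumes "bounded_clinear A" "bounded_clinear B"
  shows "bounded_clinear (\<lambda>x. A x - B x)"
  using assms unfolding bounded_clinear_def
  by (auto intro: bounded_linear_sub simp: scaleC_diff_right)

text \<open>Coercivity and Cauchy-Schwarz bound \<open>S\<close> below by \<open>d\<close>, which
  yields injectivity, a closed range and an inverse of norm at most \<open>1 / d\<close>. A vector
  orthogonal to the range vanishes by coercivity, so the range is everything.\<close>

lemma lax_milgram:
  assumes S: "bounded_clinear S" and "0 < d"
    and coercive: "\<And>x. d * (norm x)\<^sup>2 \<le> cmod (cinner (S x) x)"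
  shows "bounded_invertible S"
proof -
  note S_simps = bounded_clinearD[OF S]
  have bound: "d * norm x \<le> norm (S x)" for x
  proof (cases "x = 0")
    case False
    have "(d * norm x) * norm x \<le> norm (S x) * norm x"
      using order_trans[OF coercive norm_cinner_le[of "S x" x]]
      by (simp add: power2_eq_square)
    then show ?thesis using False by simp
  qed (simp add: S_simps)
  have inj: "x = y" if "S x = S y" for x y
    using bound[of "x - y"] that \<open>0 < d\<close> by (simp add: S_simps mult_le_0_iff)
  have "complete (S ` UNIV)"
    using bound \<open>0 < d\<close> by (intro complete_isometric_image[of d] S_simps(1)) (auto simp: complete_UNIV)
  then have "closed (range S)"
    by (rule complete_imp_closed)
  moreover have range_S: "complex_subspace (range S)"
    by (rule complex_subspace_range) (simp_all add: S_simps)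
  moreover have "z = 0" if "z \<in> ortho_compl (range S)" for z
  proof -
    have "cinner z (S z) = 0"
      using that by (simp add: ortho_compl_def)
    then have "cinner (S z) z = 0"
      by (metis cinner_commute complex_cnj_zero)
    then show ?thesis
      using coercive[of z] \<open>0 < d\<close> by (simp add: mult_le_0_iff)
  qed
  ultimately have surj: "\<exists>x. S x = y" for y
    using ex_orthogonal_decomposition[of "range S" y]
    by (metis eq_iff_diff_eq_0 rangeE)
  then obtain B where B: "\<And>y. S (B y) = y" by metis
  have "bounded_clinear B"
  proof (rule bounded_clinear_intro)
    show "B (x + y) = B x + B y" for x y
      by (rule inj) (simp add: S_simps B)
    show "B (c *\<^sub>C x) = c *\<^sub>C B x" for c x
      by (rule inj) (simp add: S_simps B)
    show "norm (B x) \<le> norm x * inverse d" for x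
      using bound[of "B x"] \<open>0 < d\<close> by (simp add: B field_simps)
  qed
  moreover have "B (S x) = x" for x
    by (rule inj) (simp add: B)
  ultimately show ?thesis
    using B unfolding bounded_invertible_def by blast
qed

subsection \<open>The spectrum of a positive operator\<close>

text \<open>A numerical range argument: the Rayleigh quotients of \<open>A\<close> (\<open>t\<close>
  in the proof) lie in the nonnegative half-line, so a positive distance \<open>d\<close> from it
  makes \<open>\<mu> - A\<close> coercive.\<close>

lemma not_in_op_spectrum_positive:
  assumes A: "positive_op A" and "0 < d" and d: "\<And>t. 0 \<le> t \<Longrightarrow> d \<le> cmod (\<mu> - complex_of_real t)"
  shows "\<mu> \<notin> op_spectrum A"
proof -
  have A': "bounded_clinear A" using A by (simp add: positive_op_def)
  have "d * (norm x)\<^sup>2 \<le> cmod (cinner (\<mu> *\<^sub>C x - A x) x)" for x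
  proof (cases "x = 0")
    case False
    obtain s where s: "0 \<le> s" "cinner (A x) x = complex_of_real s"
      using A unfolding positive_op_def nonneg_Reals_def by blast
    define t where "t = s / (norm x)\<^sup>2"
    have "cinner (\<mu> *\<^sub>C x - A x) x = (\<mu> - complex_of_real t) * complex_of_real ((norm x)\<^sup>2)"
      using False by (simp add: cinner_diff_left cinner_scaleC_left cinner_self s t_def field_simps)
    then have "cmod (cinner (\<mu> *\<^sub>C x - A x) x) = cmod (\<mu> - complex_of_real t) * (norm x)\<^sup>2"
      by (simp add: norm_mult norm_power)
    moreover have "d \<le> cmod (\<mu> - complex_of_real t)"
      by (rule d) (simp add: t_def s)
    ultimately show ?thesis
      by (simp add: mult_right_mono)
  qed simp
  then have "bounded_invertible (\<lambda>x. \<mu> *\<^sub>C x - A x)"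
    using \<open>0 < d\<close> by (intro lax_milgram bounded_clinear_diff bounded_clinear_scaleC A')
  then show ?thesis by (simp add: op_spectrum_iff)
qed

lemma op_spectrum_positive:
  assumes A: "positive_op A" and \<mu>: "\<mu> \<in> op_spectrum A"
  shows "\<mu> \<in> \<real>\<^sub>\<ge>\<^sub>0"
proof (rule ccontr)
  assume "\<mu> \<notin> \<real>\<^sub>\<ge>\<^sub>0"
  then have nonneg: "Re \<mu> < 0 \<or> Im \<mu> \<noteq> 0"
    by (auto simp: complex_nonneg_Reals_iff)
  \<comment> \<open>The distance to the half-line is bounded below by \<open>- Re \<mu>\<close> on
    the negative axis and by \<open>\<bar>Im \<mu>\<bar>\<close> off the real axis.\<close>
  have "\<exists>d>0. \<forall>t\<ge>0. d \<le> cmod (\<mu> - complex_of_real t)"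
  proof (cases "Im \<mu> = 0")
    case True
    then have "- Re \<mu> \<le> cmod (\<mu> - complex_of_real t)" if "0 \<le> t" for t
      using abs_Re_le_cmod[of "\<mu> - complex_of_real t"] that by simp
    then show ?thesis using nonneg True by (intro exI[of _ "- Re \<mu>"]) auto
  next
    case False
    then show ?thesis
      using abs_Im_le_cmod[of "\<mu> - complex_of_real _"] by (intro exI[of _ "\<bar>Im \<mu>\<bar>"]) auto
  qed
  then show False
    using not_in_op_spectrum_positive[OF A] \<mu> by blast
qed

text \<open>Beyond an operator bound \<open>K\<close>, \<open>\<mu> - A\<close> is coercive with
  constant \<open>cmod \<mu> - K\<close>. The bound makes the supremum over the spectrum
  meaningful.\<close>

lemma op_spectrum_norm_le:
  assumes A: "bounded_clinear A"
  obtains K where "\<And>\<mu>. \<mu> \<in> op_spectrum A \<Longrightarrow> cmod \<mu> \<le> K"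
proof -
  obtain K where K: "\<And>x. norm (A x) \<le> norm x * K"
    using bounded_linear.bounded[OF bounded_clinearD(1)[OF A]] by blast
  have "cmod \<mu> \<le> K" if "\<mu> \<in> op_spectrum A" for \<mu>
  proof (rule ccontr)
    assume "\<not> cmod \<mu> \<le> K"
    have "(cmod \<mu> - K) * (norm x)\<^sup>2 \<le> cmod (cinner (\<mu> *\<^sub>C x - A x) x)" for x
    proof -
      have "cmod (cinner (A x) x) \<le> (norm x * K) * norm x"
        using norm_cinner_le[of "A x" x] K[of x] by (meson mult_right_mono norm_ge_zero order_trans)
      moreover have "cmod (\<mu> * cinner x x) = cmod \<mu> * (norm x)\<^sup>2"
        by (simp add: norm_mult cinner_self norm_power)
      ultimately show ?thesis
        using norm_triangle_ineq2[of "\<mu> * cinner x x" "cinner (A x) x"]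
        by (simp add: cinner_diff_left cinner_scaleC_left power2_eq_square algebra_simps)
    qed
    then have "bounded_invertible (\<lambda>x. \<mu> *\<^sub>C x - A x)"
      using \<open>\<not> cmod \<mu> \<le> K\<close>
      by (intro lax_milgram[of _ "cmod \<mu> - K"] bounded_clinear_diff bounded_clinear_scaleC A) auto
    then show False
      using that by (simp add: op_spectrum_iff)
  qed
  then show thesis by (rule that)
qed

subsection \<open>Proper splittings\<close>

lemma mp_inverse_splitting:
  assumes T: "bounded_clinear T" and split: "proper_splitting T U V"
  shows "mp_inverse T (V x)
           = mp_inverse U (V x) + mp_inverse T (V (mp_inverse U (V x)))"
proof -
  have U: "bounded_clinear U" and T_def: "T = (\<lambda>x. U x - V x)"
    and range: "range U = range T" and null: "nullspace U = nullspace T"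
    using split unfolding proper_splitting_def by auto
  have V_range: "V x \<in> range T" for x
  proof -
    \<comment> \<open>\<open>V = U - T\<close>, and the common range is a subspace. Both inverses
      are thus evaluated at range points.\<close>
    have "U x - T x \<in> range T"
      using range complex_subspaceD(4)[OF complex_subspace_range[OF bounded_clinearD(2)[OF T] bounded_clinearD(4)[OF T]]]
      by blast
    then show ?thesis by (simp add: T_def)
  qed
  define y where "y = mp_inverse U (V x)"
  have y: "y \<in> ortho_compl (nullspace T)" "U y = V x"
    using mp_inverse_range[OF U, of "V x"] V_range[of x] by (simp_all add: y_def range null)
  have W: "mp_inverse T (V z) \<in> ortho_compl (nullspace T)" "T (mp_inverse T (V z)) = V z" for z
    using mp_inverse_range[OF T V_range] by auto
  have "mp_inverse T (V x) = y + mp_inverse T (V y)"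
  proof (rule inj_onD[OF inj_on_ortho_compl_nullspace[OF T]])
    \<comment> \<open>\<open>T\<close> sends the candidate to \<open>T y + V y = U y\<close>, which
      is \<open>V x\<close> by the choice of \<open>y\<close>.\<close>
    have "T (y + mp_inverse T (V y)) = T y + V y"
      by (simp only: bounded_clinearD(2)[OF T] W(2))
    also have "\<dots> = V x"
      by (simp add: T_def y(2))
    finally show "T (mp_inverse T (V x)) = T (y + mp_inverse T (V y))"
      by (simp only: W(2))
    show "y + mp_inverse T (V y) \<in> ortho_compl (nullspace T)"
      by (rule complex_subspaceD(2)[OF complex_subspace_ortho_compl y(1) W(1)])
  qed (rule W(1))
  then show ?thesis by (simp only: y_def)
qed

text \<open>From \<open>(I + W)(\<mu> - A) = (1 - \<mu>)(\<mu>/(1 - \<mu>) - W)\<close>.\<close>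

lemma op_spectrum_iff_moebius:
  assumes W: "bounded_clinear W" and inv: "bounded_invertible (\<lambda>x. x + W x)"
    and A: "\<And>x. W x = A x + W (A x)"
  shows "\<mu> \<in> op_spectrum A \<longleftrightarrow> \<mu> \<noteq> 1 \<and> \<mu> / (1 - \<mu>) \<in> op_spectrum W"
proof -
  note W_simps = bounded_clinearD[OF W]
  have J: "bounded_clinear (\<lambda>x. x + W x)"
    using W unfolding bounded_clinear_def
    by (auto intro: bounded_linear_add bounded_linear_ident simp: scaleC_add_right)
  \<comment> \<open>Grouped so that \<open>A x + W (A x)\<close> appears and can be replaced by
    \<open>W x\<close>.\<close>
  have "(\<mu> *\<^sub>C x - A x) + W (\<mu> *\<^sub>C x - A x) = \<mu> *\<^sub>C x + (\<mu> *\<^sub>C W x - (A x + W (A x)))" for x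
    by (simp add: W_simps algebra_simps)
  then have *: "(\<mu> *\<^sub>C x - A x) + W (\<mu> *\<^sub>C x - A x) = \<mu> *\<^sub>C x - (1 - \<mu>) *\<^sub>C W x" for x
    by (simp add: A[symmetric] scaleC_diff_left scaleC_one)
  have "bounded_invertible (\<lambda>x. \<mu> *\<^sub>C x - A x)
      \<longleftrightarrow> bounded_invertible (\<lambda>x. \<mu> *\<^sub>C x - (1 - \<mu>) *\<^sub>C W x)"
    using bounded_invertible_compose_iff[OF inv J, of "\<lambda>x. \<mu> *\<^sub>C x - A x"] by (simp add: *)
  \<comment> \<open>At \<open>\<mu> = 1\<close> the operator is the identity, so 1 is never in the
    spectrum of \<open>A\<close>; otherwise the scalar \<open>1 - \<mu>\<close> factors out.\<close>
  also have "\<dots> \<longleftrightarrow> \<mu> = 1 \<or> bounded_invertible (\<lambda>x. (\<mu> / (1 - \<mu>)) *\<^sub>C x - W x)"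
  proof (cases "\<mu> = 1")
    case True
    then show ?thesis
      using bounded_invertible_scaleC[of 1] by simp
  next
    case False
    then have "\<mu> *\<^sub>C x - (1 - \<mu>) *\<^sub>C W x = (1 - \<mu>) *\<^sub>C ((\<mu> / (1 - \<mu>)) *\<^sub>C x - W x)" for x
      by (simp add: scaleC_diff_right scaleC_scaleC)
    then show ?thesis
      using False bounded_invertible_compose_iff[OF bounded_invertible_scaleC bounded_clinear_scaleC,
          of "1 - \<mu>" "\<lambda>x. (\<mu> / (1 - \<mu>)) *\<^sub>C x - W x"] by simp
  qed
  finally show ?thesis by (simp add: op_spectrum_iff)
qed

text \<open>The moduli of the spectrum of \<open>A\<close> are the images of those of
  \<open>W\<close> under \<open>t / (1 + t)\<close>, the inverse of the Moebius map. Nonnegativity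
  is recorded because it gives the strict bound by 1.\<close>

lemma op_spectral_radius_moebius:
  assumes W: "positive_op W" and A: "\<And>x. W x = A x + W (A x)"
  shows "op_spectral_radius A = op_spectral_radius W / (1 + op_spectral_radius W)"
    and "0 \<le> op_spectral_radius W"
proof -
  have W': "bounded_clinear W" using W by (simp add: positive_op_def)
  have "- 1 \<notin> op_spectrum W"
    using op_spectrum_positive[OF W, of "- 1"] by (auto simp: complex_nonneg_Reals_iff)
  then have "bounded_invertible (\<lambda>x. (- 1) *\<^sub>C x - W x)"
    by (simp only: op_spectrum_iff not_not)
  \<comment> \<open>Negating turns \<open>- I - W\<close> into \<open>I + W\<close>.\<close>
  then have "bounded_invertible (\<lambda>x. (- 1) *\<^sub>C ((- 1) *\<^sub>C x - W x))"
    by (rule bounded_invertible_compose[OF bounded_invertible_scaleC, rotated]) simp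
  then have "bounded_invertible (\<lambda>x. x + W x)"
    by (simp add: minus_scaleC scaleC_one add.commute)
  note spec = op_spectrum_iff_moebius[OF W' this A]
  define S where "S = cmod ` op_spectrum W"
  define f where "f t = t / (1 + t)" for t :: real
  have real: "\<mu> = complex_of_real (cmod \<mu>)" if "\<mu> \<in> op_spectrum W" for \<mu>
    using op_spectrum_positive[OF W that] by (auto simp: nonneg_Reals_def)
  have bdd: "bdd_above S"
  proof -
    obtain K where "\<And>\<mu>. \<mu> \<in> op_spectrum W \<Longrightarrow> cmod \<mu> \<le> K"
      using op_spectrum_norm_le[OF W'] by blast
    then show ?thesis unfolding S_def by (rule bdd_aboveI2)
  qed
  have S_nonneg: "0 \<le> t" if "t \<in> S" for t
    using that by (auto simp: S_def)
  have cmod_A: "cmod ` op_spectrum A = f ` S"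
  proof (intro equalityI subsetI)
    fix r assume "r \<in> cmod ` op_spectrum A"
    then obtain \<mu> where \<mu>: "r = cmod \<mu>" "\<mu> \<in> op_spectrum A" by blast
    then have \<nu>: "\<mu> \<noteq> 1" "\<mu> / (1 - \<mu>) \<in> op_spectrum W" by (simp_all add: spec)
    define t where "t = cmod (\<mu> / (1 - \<mu>))"
    have "0 \<le> t" "t \<in> S" using \<nu> by (simp_all add: t_def S_def)
    have "\<mu> / (1 - \<mu>) = complex_of_real t"
      unfolding t_def by (rule real[OF \<nu>(2)])
    \<comment> \<open>Clearing the denominator of \<open>\<mu> / (1 - \<mu>) = t\<close> isolates
      \<open>\<mu>\<close>; taking moduli gives \<open>f t\<close>, since \<open>1 + t\<close> is
      positive.\<close>
    then have "\<mu> * complex_of_real (1 + t) = complex_of_real t"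
      using \<nu>(1) by (simp add: field_simps)
    then have "cmod \<mu> * cmod (complex_of_real (1 + t)) = cmod (complex_of_real t)"
      by (metis norm_mult)
    then have "cmod \<mu> * (1 + t) = t"
      using \<open>0 \<le> t\<close> by (simp only: norm_of_real)
    moreover have "1 + t \<noteq> 0" using \<open>0 \<le> t\<close> by simp
    ultimately have "r = f t"
      unfolding \<mu>(1) f_def by (metis nonzero_eq_divide_eq)
    then show "r \<in> f ` S" using \<open>t \<in> S\<close> by (rule image_eqI)
  next
    fix r assume "r \<in> f ` S"
    then obtain \<nu> where \<nu>: "\<nu> \<in> op_spectrum W" "r = f (cmod \<nu>)" by (auto simp: S_def)
    define t where "t = cmod \<nu>"
    have \<nu>_t: "\<nu> = complex_of_real t"
      unfolding t_def by (rule real[OF \<nu>(1)])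
    have t: "0 \<le> t" "r = t / (1 + t)"
      by (simp_all add: t_def f_def \<nu>(2))
    \<comment> \<open>The witness in the spectrum of \<open>A\<close> is \<open>r\<close> itself as
      a complex number; this identity gives both \<open>r / (1 - r) = t\<close> and
      \<open>r \<noteq> 1\<close>.\<close>
    have diff: "1 - r = 1 / (1 + t)"
      using t(1) unfolding t(2) by (simp add: field_simps)
    have "r / (1 - r) = t"
      unfolding diff using t by simp
    then have "complex_of_real r / (1 - complex_of_real r) = \<nu>"
      unfolding \<nu>_t by (metis of_real_1 of_real_diff of_real_divide)
    moreover have "r \<noteq> 1"
      using diff t(1) by auto
    ultimately have "complex_of_real r \<in> op_spectrum A"
      unfolding spec using \<nu>(1) by (metis of_real_eq_1_iff)
    moreover have "0 \<le> r"
      unfolding t(2) using t(1) by simp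
    then have "r = cmod (complex_of_real r)" by simp
    ultimately show "r \<in> cmod ` op_spectrum A" by (intro image_eqI)
  qed
  have "op_spectral_radius A = f (op_spectral_radius W) \<and> 0 \<le> op_spectral_radius W"
  proof (cases "S = {}")
    case True
    \<comment> \<open>Both radii then take the default value 0, which \<open>f\<close>
      fixes.\<close>
    then have "op_spectrum W = {}" "op_spectrum A = {}"
      using cmod_A by (simp_all add: S_def)
    then show ?thesis by (simp add: op_spectral_radius_def f_def)
  next
    case False
    then have "op_spectrum W \<noteq> {}" "op_spectrum A \<noteq> {}"
      using cmod_A by (auto simp only: S_def image_is_empty)
    then have rad: "op_spectral_radius W = Sup S" "op_spectral_radius A = Sup (f ` S)"
      by (simp_all only: op_spectral_radius_def if_False flip: S_def cmod_A)
    obtain s where s: "s \<in> S" using False by blast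
    have nonneg: "0 \<le> Sup S"
      by (rule order_trans[OF S_nonneg[OF s] cSup_upper[OF s bdd]])
    \<comment> \<open>\<open>f\<close> is monotone only on the nonnegative half-line, so it is replaced by a globally monotone
      function agreeing with it there.\<close>
    define g where "g t = f (max 0 t)" for t
    have f_mono: "f s \<le> f t" if "0 \<le> s" "s \<le> t" for s t
      using that by (simp add: f_def divide_simps) (simp add: algebra_simps)
    have "mono g"
      unfolding g_def by (intro monoI f_mono) auto
    \<comment> \<open>Continuity at the supremum, together with monotonicity, lets \<open>g\<close>
      commute with it; the denominator of \<open>g\<close> is at least 1.\<close>
    moreover have "isCont g (Sup S)"
      unfolding g_def f_def using nonneg by (intro continuous_intros) auto
    then have "continuous (at_left (Sup S)) g"
      by (rule continuous_at_imp_continuous_at_within)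
    ultimately have "g (Sup S) = Sup (g ` S)"
      using False bdd by (rule continuous_at_Sup_mono)
    moreover have "g ` S = f ` S"
      by (rule image_cong) (simp_all add: g_def S_nonneg)
    moreover have "g (Sup S) = f (Sup S)"
      using nonneg by (simp add: g_def)
    ultimately show ?thesis
      unfolding rad using nonneg by metis
  qed
  then show "op_spectral_radius A = op_spectral_radius W / (1 + op_spectral_radius W)"
    "0 \<le> op_spectral_radius W"
    by (simp_all add: f_def)
qed

theorem theorem3p5:
  fixes T U V :: "'a::complex_hilbert_space \<Rightarrow> 'a"
  assumes "bounded_clinear T"
    and "proper_splitting T U V"
    and "positive_op (mp_inverse T \<circ> V)"
  shows "op_spectral_radius (mp_inverse U \<circ> V) =
           op_spectral_radius (mp_inverse T \<circ> V) / (1 + op_spectral_radius (mp_inverse T \<circ> V))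
         \<and> op_spectral_radius (mp_inverse T \<circ> V) / (1 + op_spectral_radius (mp_inverse T \<circ> V)) < 1"
proof -
  have "(mp_inverse T \<circ> V) x = (mp_inverse U \<circ> V) x + (mp_inverse T \<circ> V) ((mp_inverse U \<circ> V) x)" for x
    using mp_inverse_splitting[OF assms(1,2), of x] by simp
  note radius = op_spectral_radius_moebius[OF assms(3) this]
  have "r / (1 + r) < 1" if "0 \<le> r" for r :: real
    using that by simp
  with radius show ?thesis by blast
qed

end
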